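(* Let $n$ be a positive integer. For every integer $k$ with $0\leq k \leq \binom{n}{2}$, the over-Mahonian numbers satisfy $$i_{B'}(n,k)=i_{B'}(n,k-1)+i_{B'}(n-1,k)+i_{B'}(n-1,k-1)-2\,i_{B'}(n-1,k-n).$$
   Context: For $n\ge 1$, $B'_n$ denotes the set of overlined permutations of $\{1,\dots,n\}$ of the following kind: an element is a permutation $\sigma=\sigma_1\sigma_2\cdots\sigma_n$ of $\{1,\dots,n\}$ (in one-line notation) in which each entry $\sigma_i$ is independently either overlined or not overlined, subject to the condition that $\sigma_i$ may be overlined only if there is an index $j>i$ with $\sigma_i>\sigma_j$ (overlines are ignored in comparing entries). An inversion of such an element is a pair of positions $i<j$ with $\sigma_i>\sigma_j$, again ignoring overlines. The over-Mahonian number $i_{B'}(n,k)$ is the number of elements of $B'_n$ with exactly $k$ inversions; it is $0$ for integers $k$ outside $0\le k\le\binom n2$ (in particular for negative $k$). For $n=0$ the convention is $i_{B'}(0,0)=1$ and $i_{B'}(0,k)=0$ for $k\neq 0$. *)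

theory Defs
  imports Complex_Main "HOL-Combinatorics.Permutations"
begin

definition inversions :: "nat \<Rightarrow> (nat \<Rightarrow> nat) \<Rightarrow> (nat \<times> nat) set" where
  "inversions n \<sigma> = {(i, j). i \<in> {1..n} \<and> j \<in> {1..n} \<and> i < j \<and> \<sigma> i > \<sigma> j}"

text \<open>
  An overlined permutation is a pair \<open>(\<sigma>, S)\<close>: \<open>\<sigma>\<close> is a permutation of \<open>{1..n}\<close>, read in
  one-line notation as \<open>\<sigma> 1, \<dots>, \<sigma> n\<close>, and \<open>S\<close> is the set of positions whose entry is
  overlined.
\<close>

definition overlined_perms :: "nat \<Rightarrow> ((nat \<Rightarrow> nat) \<times> nat set) set" where
  "overlined_perms n =
     {(\<sigma>, S). \<sigma> permutes {1..n} \<and> S \<subseteq> {1..n} \<and>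
              (\<forall>i\<in>S. \<exists>j\<in>{1..n}. j > i \<and> \<sigma> i > \<sigma> j)}"

text \<open>
  The second argument ranges over all integers, so that the number is \<open>0\<close> for negative \<open>k\<close>.
\<close>

definition over_mahonian :: "nat \<Rightarrow> int \<Rightarrow> nat" where
  "over_mahonian n k = card {(\<sigma>, S) \<in> overlined_perms n. int (card (inversions n \<sigma>)) = k}"

lemma finite_overlined_perms: "finite (overlined_perms n)"
proof (rule finite_subset)
  show "overlined_perms n \<subseteq> {\<sigma>. \<sigma> permutes {1..n}} \<times> Pow {1..n}"
    by (auto simp: overlined_perms_def)
  show "finite ({\<sigma>. \<sigma> permutes {1..n}} \<times> Pow {1..n})"
    by (simp add: finite_permutations)
qed

text \<open>
  The convention for \<open>n = 0\<close> needs no separate clause: the empty permutation is counted once.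
\<close>

lemma over_mahonian_0: "over_mahonian 0 k = (if k = 0 then 1 else 0)"
proof -
  have "{(\<sigma>, S) \<in> overlined_perms 0. int (card (inversions 0 \<sigma>)) = k} =
      (if k = 0 then {(id, {})} else {})"
    by (auto simp: overlined_perms_def inversions_def)
  then show ?thesis
    by (simp add: over_mahonian_def)
qed

lemma over_mahonian_outside:
  assumes "k < 0 \<or> k > int (n choose 2)"
  shows "over_mahonian n k = 0"
proof -
  have "card (inversions n \<sigma>) \<le> n choose 2" for \<sigma>
  proof -
    have "inj_on (\<lambda>(i, j). {i, j}) (inversions n \<sigma>)"
      by (auto simp: inj_on_def inversions_def doubleton_eq_iff)
    moreover have "(\<lambda>(i, j). {i, j}) ` inversions n \<sigma> \<subseteq> {B. B \<subseteq> {1..n} \<and> card B = 2}"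
      by (auto simp: inversions_def)
    ultimately have "card (inversions n \<sigma>) \<le> card {B. B \<subseteq> {1..n} \<and> card B = 2}"
      by (intro card_inj_on_le) auto
    then show ?thesis
      by (simp add: n_subsets)
  qed
  then have "int (card (inversions n \<sigma>)) \<noteq> k" for \<sigma>
    using assms by (smt (verit) of_nat_le_iff of_nat_0_le_iff)
  then show ?thesis
    by (simp add: over_mahonian_def)
qed

end

theory Submission
  imports Defs "HOL-Computational_Algebra.Polynomial"
begin

text \<open>
  The generating polynomial \<open>P\<^sub>n(q) = \<Sum>\<^sub>k i(n,k) q\<^sup>k\<close> of the over-Mahonian numbers factors as
  \<open>\<Prod>\<^sub>m\<^sub>\<le>\<^sub>n (1 + 2q + \<dots> + 2q\<^bsup>m-1\<^esup>)\<close>. To see this, encode a permutation by its Lehmer code, whose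
  \<open>i\<close>-th entry counts the inversions starting at position \<open>i\<close> (\<open>bij_betw_lehmer_code\<close>). The codes
  are exactly the sequences with \<open>0 \<le> c\<^sub>i \<le> n - i\<close>, so the entries vary independently. The number of
  inversions is the sum of the code, and position \<open>i\<close> may be overlined exactly when \<open>c\<^sub>i > 0\<close>; hence
  each entry contributes a factor \<open>1\<close> if it vanishes and \<open>2q\<^bsup>c\<^esup>\<close> if it equals \<open>c > 0\<close>, and the
  sum over all codes is a product of independent sums (\<open>inv_poly_eq_prod\<close>).

  Multiplying the last factor by \<open>1 - q\<close> telescopes it to \<open>1 + q - 2q\<^sup>n\<close>. So
  \<open>(1 - q) P\<^sub>n = (1 + q - 2q\<^sup>n) P\<^sub>n\<^sub>-\<^sub>1\<close> (\<open>inv_poly_recurrence\<close>), and the claimed recurrence is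
  the comparison of the coefficients of \<open>q\<^sup>k\<close> on both sides.
\<close>

definition lehmer_code :: "nat \<Rightarrow> (nat \<Rightarrow> nat) \<Rightarrow> nat \<Rightarrow> nat" where
  "lehmer_code n \<sigma> = (\<lambda>i\<in>{1..n}. card {j \<in> {i<..n}. \<sigma> j < \<sigma> i})"

lemma card_inversions_eq_sum_lehmer_code:
  "card (inversions n \<sigma>) = (\<Sum>i\<in>{1..n}. lehmer_code n \<sigma> i)"
proof -
  have "inversions n \<sigma> = (SIGMA i:{1..n}. {j \<in> {i<..n}. \<sigma> j < \<sigma> i})"
    by (auto simp: inversions_def)
  then show ?thesis
    by (simp add: lehmer_code_def)
qed

lemma lehmer_code_in_PiE: "lehmer_code n \<sigma> \<in> (\<Pi>\<^sub>E i\<in>{1..n}. {..n - i})"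
proof -
  have "card {j \<in> {i<..n}. \<sigma> j < \<sigma> i} \<le> n - i" for i
    by (rule order_trans[OF card_mono[of "{i<..n}"]]) auto
  then show ?thesis
    by (auto simp: lehmer_code_def)
qed

text \<open>
  Given the values at the positions before \<open>i\<close>, the set \<open>R\<close> of values still to be placed is known,
  and the code entry at \<open>i\<close> is the rank in \<open>R\<close> of the value placed at \<open>i\<close>.
\<close>

lemma inj_on_lehmer_code: "inj_on (lehmer_code n) {\<sigma>. \<sigma> permutes {1..n}}"
proof (rule inj_onI, clarify)
  fix \<sigma> \<tau>
  assume \<sigma>: "\<sigma> permutes {1..n}" and \<tau>: "\<tau> permutes {1..n}"
    and eq: "lehmer_code n \<sigma> = lehmer_code n \<tau>"
  have code_rank: "lehmer_code n \<pi> i = card {r \<in> {1..n} - \<pi> ` {1..<i}. r < \<pi> i}"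
    if \<pi>: "\<pi> permutes {1..n}" and i: "i \<in> {1..n}" for \<pi> i
  proof -
    have inj: "inj_on \<pi> A" for A
      using permutes_inj_on[OF \<pi>] .
    have "{1..n} - \<pi> ` {1..<i} = \<pi> ` ({1..n} - {1..<i})"
      using permutes_image[OF \<pi>] permutes_inj[OF \<pi>] by (simp add: image_set_diff)
    also have "{1..n} - {1..<i} = {i..n}"
      using i by auto
    finally have "{r \<in> {1..n} - \<pi> ` {1..<i}. r < \<pi> i} = \<pi> ` {j \<in> {i<..n}. \<pi> j < \<pi> i}"
      by (force simp: order_le_less)
    then show ?thesis
      using i by (simp add: lehmer_code_def card_image inj)
  qed
  have less_rank: "card {r \<in> R. r < x} < card {r \<in> R. r < y}"
    if "x \<in> R" "x < y" "finite R" for R and x y :: nat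
    using that by (intro psubset_card_mono) auto
  have agree: "i \<in> {1..n} \<Longrightarrow> \<sigma> i = \<tau> i" for i
  proof (induction i rule: less_induct)
    case (less i)
    define R where "R = {1..n} - \<sigma> ` {1..<i}"
    have "\<sigma> ` {1..<i} = \<tau> ` {1..<i}"
      using less by (intro image_cong) auto
    then have R: "R = {1..n} - \<tau> ` {1..<i}"
      by (simp add: R_def)
    have "\<sigma> i \<in> R"
      using less.prems permutes_in_image[OF \<sigma>] permutes_inj[OF \<sigma>]
      by (auto simp: R_def dest: injD)
    moreover have "\<tau> i \<in> R"
      using less.prems permutes_in_image[OF \<tau>] permutes_inj[OF \<tau>]
      by (auto simp: R dest: injD)
    moreover have "card {r \<in> R. r < \<sigma> i} = card {r \<in> R. r < \<tau> i}"
      using code_rank[OF \<sigma> less.prems] code_rank[OF \<tau> less.prems] eq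
      unfolding R_def[symmetric] R[symmetric] by simp
    moreover have "finite R"
      by (simp add: R_def)
    ultimately show ?case
      using less_rank[of "\<sigma> i" R "\<tau> i"] less_rank[of "\<tau> i" R "\<sigma> i"]
      by (metis less_irrefl linorder_neqE_nat)
  qed
  show "\<sigma> = \<tau>"
  proof
    fix i
    show "\<sigma> i = \<tau> i"
      using agree[of i] permutes_not_in[OF \<sigma>, of i] permutes_not_in[OF \<tau>, of i] by metis
  qed
qed

text \<open>
  Surjectivity comes for free: there are \<open>n!\<close> permutations and also
  \<open>n \<cdot> (n - 1) \<cdots> 1\<close> admissible codes.
\<close>

lemma bij_betw_lehmer_code:
  "bij_betw (lehmer_code n) {\<sigma>. \<sigma> permutes {1..n}} (\<Pi>\<^sub>E i\<in>{1..n}. {..n - i})"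
  unfolding bij_betw_def
proof
  show inj: "inj_on (lehmer_code n) {\<sigma>. \<sigma> permutes {1..n}}"
    by (rule inj_on_lehmer_code)
  have "card (\<Pi>\<^sub>E i\<in>{1..n}. {..n - i}) = (\<Prod>i\<in>{1..n}. Suc (n - i))"
    by (simp add: card_PiE)
  also have "\<dots> = fact n"
    by (subst prod.atLeastAtMost_rev) (auto simp: fact_prod intro!: prod.cong)
  finally have "card (lehmer_code n ` {\<sigma>. \<sigma> permutes {1..n}}) = card (\<Pi>\<^sub>E i\<in>{1..n}. {..n - i})"
    using inj by (simp add: card_image card_permutations)
  then show "lehmer_code n ` {\<sigma>. \<sigma> permutes {1..n}} = (\<Pi>\<^sub>E i\<in>{1..n}. {..n - i})"
    using lehmer_code_in_PiE by (intro card_subset_eq) (auto intro!: finite_PiE)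
qed

definition inv_poly :: "nat \<Rightarrow> int poly" where
  "inv_poly n = (\<Sum>(\<sigma>, S)\<in>overlined_perms n. monom 1 (card (inversions n \<sigma>)))"

lemma coeff_inv_poly: "coeff (inv_poly n) k = int (over_mahonian n (int k))"
proof -
  have "coeff (inv_poly n) k =
      (\<Sum>x\<in>overlined_perms n. if card (inversions n (fst x)) = k then 1 else 0)"
    by (simp add: inv_poly_def coeff_sum case_prod_unfold)
  also have "\<dots> = int (card {x \<in> overlined_perms n. card (inversions n (fst x)) = k})"
    by (simp add: finite_overlined_perms flip: sum.inter_filter)
  also have "{x \<in> overlined_perms n. card (inversions n (fst x)) = k} =
      {(\<sigma>, S) \<in> overlined_perms n. int (card (inversions n \<sigma>)) = int k}"
    by auto
  finally show ?thesis
    by (simp add: over_mahonian_def)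
qed

lemma overlined_perms_eq_Sigma:
  "overlined_perms n =
    (SIGMA \<sigma>:{\<sigma>. \<sigma> permutes {1..n}}. Pow {i \<in> {1..n}. lehmer_code n \<sigma> i \<noteq> 0})"
proof -
  have "lehmer_code n \<sigma> i \<noteq> 0 \<longleftrightarrow> (\<exists>j\<in>{1..n}. j > i \<and> \<sigma> i > \<sigma> j)" if "i \<in> {1..n}" for \<sigma> i
    using that by (auto simp: lehmer_code_def)
  then show ?thesis
    unfolding overlined_perms_def by blast
qed

text \<open>The contribution of a code entry \<open>c\<close>, where the factor 2 is the choice of an overline.\<close>

definition entry_weight :: "nat \<Rightarrow> int poly" where
  "entry_weight c = (if c = 0 then 1 else monom 2 c)"

lemma prod_entry_weight:
  assumes "finite A"
  shows "(\<Prod>i\<in>A. entry_weight (c i)) = monom (2 ^ card {i \<in> A. c i \<noteq> 0}) (\<Sum>i\<in>A. c i)"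
  using assms
proof (induction A rule: finite_induct)
  case (insert a A)
  have "{i \<in> insert a A. c i \<noteq> 0} =
      (if c a = 0 then {i \<in> A. c i \<noteq> 0} else insert a {i \<in> A. c i \<noteq> 0})"
    by auto
  with insert show ?case
    by (simp add: entry_weight_def mult_monom)
qed simp

lemma inv_poly_eq_prod: "inv_poly n = (\<Prod>m\<in>{1..n}. \<Sum>c<m. entry_weight c)"
proof -
  let ?perms = "{\<sigma>. \<sigma> permutes {1..n}}"
  have "inv_poly n = (\<Sum>\<sigma>\<in>?perms. \<Sum>S\<in>Pow {i \<in> {1..n}. lehmer_code n \<sigma> i \<noteq> 0}.
      monom 1 (card (inversions n \<sigma>)))"
    unfolding inv_poly_def overlined_perms_eq_Sigma
    by (subst sum.Sigma) (auto simp: finite_permutations)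
  also have "\<dots> = (\<Sum>\<sigma>\<in>?perms. \<Prod>i\<in>{1..n}. entry_weight (lehmer_code n \<sigma> i))"
    by (intro sum.cong refl)
      (simp add: prod_entry_weight card_inversions_eq_sum_lehmer_code card_Pow
        of_nat_poly smult_monom)
  also have "\<dots> = (\<Sum>c\<in>(\<Pi>\<^sub>E i\<in>{1..n}. {..n - i}). \<Prod>i\<in>{1..n}. entry_weight (c i))"
    by (rule sum.reindex_bij_betw[OF bij_betw_lehmer_code])
  also have "\<dots> = (\<Prod>i\<in>{1..n}. \<Sum>c\<le>n - i. entry_weight c)"
    by (rule prod_sum_PiE[symmetric]) auto
  also have "\<dots> = (\<Prod>m\<in>{1..n}. \<Sum>c<m. entry_weight c)"
    by (subst prod.atLeastAtMost_rev) (auto intro!: prod.cong sum.cong)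
  finally show ?thesis .
qed

lemma entry_weight_sum_telescope:
  assumes "m \<ge> 1"
  shows "(1 - monom 1 1) * (\<Sum>c<m. entry_weight c) = 1 + monom 1 1 - monom 2 m"
  using assms
proof (induction m rule: dec_induct)
  case base
  have "monom (2::int) 1 = monom 1 1 + monom 1 1"
    by (simp add: add_monom)
  then show ?case
    by (simp add: entry_weight_def)
next
  case (step m)
  have "(1 - monom 1 1) * monom (2::int) m = monom 2 m - monom 2 (Suc m)"
    by (simp add: left_diff_distrib mult_monom)
  with step show ?case
    by (simp add: entry_weight_def distrib_left)
qed

lemma inv_poly_recurrence:
  assumes "n \<ge> 1"
  shows "(1 - monom 1 1) * inv_poly n = (1 + monom 1 1 - monom 2 n) * inv_poly (n - 1)"
proof -
  obtain m where n: "n = Suc m"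
    using assms by (cases n) auto
  have "inv_poly n = (\<Sum>c<n. entry_weight c) * inv_poly (n - 1)"
    by (simp add: n inv_poly_eq_prod mult.commute)
  then show ?thesis
    using entry_weight_sum_telescope[OF assms] by (simp only: mult.assoc[symmetric])
qed

text \<open>
  Since over-Mahonian numbers vanish at negative integers, the shift by \<open>q\<^sup>j\<close> is described without
  a case distinction on \<open>j \<le> k\<close>.
\<close>

lemma coeff_monom_mult_inv_poly:
  "coeff (monom a j * inv_poly n) k = a * int (over_mahonian n (int k - int j))"
  by (auto simp: coeff_monom_mult coeff_inv_poly of_nat_diff over_mahonian_outside)

theorem proposition2p8:
  fixes n :: nat and k :: int
  assumes "n \<ge> 1" and "0 \<le> k" and "k \<le> int (n choose 2)"
  shows "int (over_mahonian n k) =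
    int (over_mahonian n (k - 1)) + int (over_mahonian (n - 1) k)
      + int (over_mahonian (n - 1) (k - 1)) - 2 * int (over_mahonian (n - 1) (k - int n))"
proof -
  obtain l where k: "k = int l"
    using assms(2) nonneg_int_cases by blast
  have "coeff ((1 - monom 1 1) * inv_poly n) l =
      coeff ((1 + monom 1 1 - monom 2 n) * inv_poly (n - 1)) l"
    by (simp only: inv_poly_recurrence[OF assms(1)])
  then show ?thesis
    by (simp add: k left_diff_distrib distrib_right coeff_monom_mult_inv_poly coeff_inv_poly
        del: One_nat_def)
qed

end
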